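(* There is an absolute constant $C>0$ such that the following holds. Assume that $H^\times(a_0;a_1,a_2,\ldots,a_d)\subseteq\{x^2-n: x\in\mathbb{N}\}$, where $a_0,a_1,\ldots,a_d$ are positive integers with $2\leq a_1<a_2<\cdots<a_d$, and $n$ is a nonzero integer. Then $$d\leq C\left(2^{\frac{\omega(n(1-a_1))}{2}}+\log|n|\right).$$ In particular, $$d\leq 2^{\frac{(1+o(1))\log(a_1|n|)}{2\log\log(a_1|n|)}},$$ where $o(1)$ denotes a quantity depending only on $a_1|n|$ that tends to $0$ as $a_1|n|\to\infty$.
   Context: $\mathbb{N}$ is the set of positive integers. For a nonzero integer $u$, $\omega(u)$ is the number of distinct prime factors of $u$. For a positive integer $a_0$ and distinct positive integers $a_1,\ldots,a_d$, the multiplicative Hilbert cube is $$H^\times(a_0;a_1,\ldots,a_d)=\Big\{a_0\prod_{i\in I}a_i: I\subseteq\{1,2,\ldots,d\}\Big\},$$ where the empty product equals $1$. *)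

theory Defs
  imports Complex_Main "HOL-Computational_Algebra.Primes"
begin

text \<open>The prime factors of an integer are taken up to sign: for \<^typ>\<open>int\<close>,
  \<^term>\<open>prime p\<close> entails \<^term>\<open>p > 0\<close>.\<close>

definition omega :: "int \<Rightarrow> nat" where
  "omega u = card (prime_factors u)"

text \<open>The generators are \<open>a 1, \<dots>, a d\<close>; the other values of \<open>a\<close> are irrelevant.\<close>

definition mult_hilbert_cube :: "int \<Rightarrow> (nat \<Rightarrow> int) \<Rightarrow> nat \<Rightarrow> int set" where
  "mult_hilbert_cube a0 a d = {a0 * (\<Prod>i\<in>I. a i) | I. I \<subseteq> {1..d}}"

definition shifted_squares :: "int \<Rightarrow> int set" where
  "shifted_squares n = {x\<^sup>2 - n | x. x > 0}"

end

theory Submission imports Defs "HOL-Real_Asymp.Real_Asymp" begin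

text \<open>
  The cube satisfies \<open>d \<le> C (1 + ln \<bar>n\<bar>)\<close> for an absolute constant \<open>C\<close>. This implies the
  first estimate because \<open>2 powr (\<omega> / 2) \<ge> 1\<close>, and the second because \<open>ln \<bar>n\<bar> \<le> ln N\<close> for
  \<open>N = a 1 * \<bar>n\<bar>\<close>, while \<open>2 powr (ln N / (2 ln (ln N)))\<close> outgrows every multiple of \<open>1 + ln N\<close>.

  The logarithmic bound comes from Runge's method. Write \<open>p = a 1\<close>, \<open>q = a 2\<close>, and let
  \<open>b = a0 * a 3 * \<dots> * a d\<close>. The cube contains \<open>b\<close>, \<open>p b\<close>, \<open>q b\<close> and \<open>p q b\<close>, so the quartic
  \<open>(b + n) (p b + n) (q b + n) (p q b + n)\<close> is a perfect square. Its leading coefficient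
  \<open>(p q)\<^sup>2\<close> is a square too, so its root agrees with a quadratic polynomial in \<open>b\<close> with rational
  coefficients up to an error \<open>O(1/b)\<close>. Integrality forces the error to vanish once \<open>b\<close> exceeds a
  fixed polynomial in \<open>p\<close>, \<open>q\<close>, \<open>\<bar>n\<bar>\<close>, and then a linear equation bounds \<open>b\<close> after all. The
  outcome is \<open>b \<le> 20 \<bar>n\<bar>\<^sup>3 (p q)\<^sup>2\<close> (lemma \<open>runge_bound\<close>). On the other hand \<open>b\<close>
  contains \<open>d - 2\<close> factors that exceed \<open>q\<close>, and \<open>p q < q\<^sup>2\<close>, so for \<open>d \<ge> 6\<close> the power
  \<open>q ^ (d - 6)\<close> is at most \<open>20 \<bar>n\<bar>\<^sup>3\<close> (lemma \<open>cube_dimension_le\<close>).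
\<close>

section \<open>Runge's method for four linear forms\<close>

text \<open>
  With \<open>U = (b + n) (p q b + n)\<close> and \<open>V = (p b + n) (q b + n)\<close>, the identity
  \<open>4 U V = (U + V)\<^sup>2 - (U - V)\<^sup>2\<close> isolates the approximate root: \<open>U + V\<close> is
  quadratic in \<open>b\<close>, but \<open>U - V = n (p - 1) (q - 1) b\<close> is only linear. Hence the root of \<open>4 U V\<close>
  lies below \<open>U + V\<close> by an amount \<open>c\<close> that stays bounded as \<open>b\<close> grows.
\<close>

lemma runge_bound:
  fixes b n p q :: int
  assumes b: "b > 0" and n: "n \<noteq> 0" and p: "p \<ge> 2" and pq: "p < q"
    and sq: "b + n = x1\<^sup>2" "p * b + n = x2\<^sup>2" "q * b + n = x3\<^sup>2" "p * q * b + n = x4\<^sup>2"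
  shows "b \<le> 20 * \<bar>n\<bar> ^ 3 * (p * q)\<^sup>2"
proof (rule ccontr)
  assume nle: "\<not> ?thesis"
  define s where "s = p * q"
  define t where "t = (1 + p) * (1 + q)"
  define m where "m = \<bar>n\<bar>"
  define e where "e = n * ((p - 1) * (q - 1))"
  define S where "S = 2 * s * b\<^sup>2 + n * t * b + 2 * n\<^sup>2"
  define w where "w = 2 * \<bar>x1 * x2 * x3 * x4\<bar>"
  define c where "c = S - w"
  have big: "b > 20 * m ^ 3 * s\<^sup>2"
    using nle by (simp add: m_def s_def)
  have m: "m \<ge> 1" using n by (simp add: m_def)
  have n2: "n\<^sup>2 = m\<^sup>2" by (simp add: m_def)
  have s6: "s \<ge> 6"
    using mult_mono[of 2 p 3 q] p pq by (simp add: s_def)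
  have "p * 2 \<le> s" "2 * q \<le> s"
    using p pq by (auto simp: s_def intro: mult_left_mono mult_right_mono)
  moreover have "t = 1 + p + q + s" by (simp add: t_def s_def algebra_simps)
  ultimately have t4: "t \<le> 4 * s" "t \<ge> 0" and ts: "t \<ge> s"
    using s6 p pq by linarith+
  have pq1: "0 < (p - 1) * (q - 1)" "(p - 1) * (q - 1) \<le> s"
    using p pq by (auto simp: s_def intro!: mult_mono)
  have e0: "e \<noteq> 0" using n p pq by (simp add: e_def)
  have e2: "e\<^sup>2 \<le> m\<^sup>2 * s\<^sup>2"
  proof -
    have "((p - 1) * (q - 1))\<^sup>2 \<le> s\<^sup>2" using pq1 by (intro power_mono) linarith+
    hence "m\<^sup>2 * ((p - 1) * (q - 1))\<^sup>2 \<le> m\<^sup>2 * s\<^sup>2" by (intro mult_left_mono) auto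
    thus ?thesis unfolding e_def power_mult_distrib[of n] n2 .
  qed
  have m3: "m ^ 3 \<ge> m"
    using m power_increasing[of 1 3 m] by simp
  have s2: "s\<^sup>2 \<ge> 6 * s" using s6 by (simp add: power2_eq_square)
  have "m * 1 \<le> m ^ 3 * s\<^sup>2"
    using m3 m s6 s2 by (intro mult_mono) auto
  hence bm: "20 * m \<le> b" using big by simp
  have w2: "w\<^sup>2 = S\<^sup>2 - e\<^sup>2 * b\<^sup>2"
  proof -
    have "w\<^sup>2 = 4 * (x1\<^sup>2 * x2\<^sup>2 * x3\<^sup>2 * x4\<^sup>2)"
      by (simp add: w_def power_mult_distrib)
    also have "\<dots> = S\<^sup>2 - e\<^sup>2 * b\<^sup>2"
      unfolding sq[symmetric] S_def e_def s_def t_def by algebra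
    finally show ?thesis .
  qed
  have ntb: "\<bar>n * t * b\<bar> \<le> 4 * m * s * b"
  proof -
    have "\<bar>n * t * b\<bar> = m * t * b" using t4 b by (simp add: abs_mult m_def)
    also have "\<dots> \<le> m * (4 * s) * b"
      using t4 m b by (intro mult_right_mono mult_left_mono) auto
    finally show ?thesis by simp
  qed
  have Sb: "S \<ge> s * b\<^sup>2"
  proof -
    have "4 * m * s * b \<le> b * s * b"
      using bm m s6 b by (intro mult_right_mono) auto
    hence "4 * m * s * b \<le> s * b\<^sup>2" by (simp add: power2_eq_square mult_ac)
    moreover have "S = s * b\<^sup>2 + (s * b\<^sup>2 + n * t * b + 2 * n\<^sup>2)" by (simp add: S_def)
    moreover have "n\<^sup>2 \<ge> 0" by simp
    ultimately show ?thesis using ntb by linarith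
  qed
  have "s * b\<^sup>2 > 0" using s6 b by simp
  hence S0: "S > 0" using Sb by linarith
  have w0: "w \<ge> 0" by (simp add: w_def)
  have ceq: "c * (S + w) = e\<^sup>2 * b\<^sup>2"
    using w2 by (simp add: c_def algebra_simps power2_eq_square)
  have "c * (S + w) > 0" using ceq e0 b by simp
  hence c0: "c > 0" using S0 w0 by (simp add: zero_less_mult_iff)
  have "c * s * b\<^sup>2 \<le> e\<^sup>2 * b\<^sup>2"
  proof -
    have "c * (s * b\<^sup>2) \<le> c * (S + w)"
      using Sb w0 c0 by (intro mult_left_mono) auto
    thus ?thesis using ceq by (simp add: mult.assoc)
  qed
  hence "c * s \<le> m\<^sup>2 * s\<^sup>2" using b e2 by simp
  hence cs: "c \<le> m\<^sup>2 * s"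
    using s6 by (simp add: power2_eq_square)
  \<comment> \<open>Since \<open>S\<close> and \<open>w\<close> are both close to \<open>2 s b\<^sup>2\<close>, \<open>c\<close> is close to \<open>e\<^sup>2 / (4 s)\<close>. The
    integer \<open>k\<close> is the difference cleared of its denominator, and it is of order \<open>1/b\<close>.\<close>
  define k where "k = e\<^sup>2 - 4 * s * c"
  have keq: "k * b\<^sup>2 = c * (2 * (n * t * b) + 4 * n\<^sup>2 - c)"
  proof -
    have "c * (2 * S - c) = e\<^sup>2 * b\<^sup>2" using ceq by (simp add: c_def)
    thus ?thesis by (simp add: k_def S_def algebra_simps power2_eq_square)
  qed
  have inner: "\<bar>2 * (n * t * b) + 4 * n\<^sup>2 - c\<bar> \<le> 8 * m * s * b + 2 * (m\<^sup>2 * s)"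
  proof -
    have "4 * m\<^sup>2 \<le> s * m\<^sup>2" using s6 by (intro mult_right_mono) auto
    moreover have "8 * m * s * b = 2 * (4 * m * s * b)" "s * m\<^sup>2 = m\<^sup>2 * s" "n\<^sup>2 \<ge> 0" by simp_all
    ultimately show ?thesis using ntb cs c0 unfolding n2 by linarith
  qed
  have "\<bar>k * b\<^sup>2\<bar> < b\<^sup>2"
  proof -
    have "\<bar>k * b\<^sup>2\<bar> \<le> (m\<^sup>2 * s) * (8 * m * s * b + 2 * (m\<^sup>2 * s))"
      unfolding keq abs_mult using inner cs c0 by (intro mult_mono) auto
    also have "\<dots> = (m ^ 3 * s\<^sup>2) * (8 * b + 2 * m)"
      by (simp add: algebra_simps power2_eq_square power3_eq_cube)
    also have "\<dots> \<le> (m ^ 3 * s\<^sup>2) * (9 * b)"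
      using bm m by (intro mult_left_mono) auto
    also have "\<dots> \<le> (20 * m ^ 3 * s\<^sup>2) * b"
      using b m by simp
    also have "\<dots> < b * b"
      using big b by (intro mult_strict_right_mono) auto
    finally show ?thesis by (simp add: power2_eq_square)
  qed
  hence "k = 0" using b by (simp add: abs_mult)
  \<comment> \<open>This is the linear equation for \<open>b\<close>: both \<open>c\<close> and \<open>n\<^sup>2\<close> are bounded independently of \<open>b\<close>.\<close>
  hence "2 * (n * t * b) = c - 4 * n\<^sup>2" using keq c0 by simp
  moreover have "n\<^sup>2 \<ge> 0" by simp
  ultimately have "\<bar>2 * (n * t * b)\<bar> \<le> m\<^sup>2 * s + 4 * m\<^sup>2"
    using cs c0 unfolding n2 by linarith
  also have "\<dots> \<le> 2 * (m\<^sup>2 * s)"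
  proof -
    have "4 * m\<^sup>2 \<le> s * m\<^sup>2" using s6 by (intro mult_right_mono) auto
    thus ?thesis by (simp add: mult.commute)
  qed
  finally have "m * (t * b) \<le> m * (m * s)"
    using t4 b by (simp add: abs_mult m_def power2_eq_square mult.assoc)
  hence "t * b \<le> m * s" using m by simp
  moreover have "s * b \<le> t * b" using ts b by simp
  ultimately have "s * b \<le> s * m" by (simp add: mult.commute)
  hence "b \<le> m" using s6 by simp
  thus False using bm m by simp
qed

section \<open>The dimension of the cube\<close>

lemma mult_hilbert_cube_shifted_square:
  assumes "mult_hilbert_cube a0 a d \<subseteq> shifted_squares n" and "I \<subseteq> {1..d}"
  obtains x where "a0 * (\<Prod>i\<in>I. a i) + n = x\<^sup>2"
proof -
  have "a0 * (\<Prod>i\<in>I. a i) \<in> shifted_squares n"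
    using assms by (auto simp: mult_hilbert_cube_def)
  thus ?thesis using that by (auto simp: shifted_squares_def)
qed

lemma cube_dimension_le:
  fixes a :: "nat \<Rightarrow> int"
  assumes a0: "a0 > 0" and a1: "a 1 \<ge> 2" and mono: "strict_mono_on {1..d} a" and n: "n \<noteq> 0"
    and cube: "mult_hilbert_cube a0 a d \<subseteq> shifted_squares n"
  shows "real d \<le> 6 + ln 20 + 3 * ln (real_of_int \<bar>n\<bar>)"
proof (cases "d \<ge> 6")
  case False
  have "ln (real_of_int \<bar>n\<bar>) \<ge> 0" using n by (intro ln_ge_zero) linarith
  moreover have "ln (20 :: real) \<ge> 0" by simp
  moreover have "real d \<le> 6" using False by simp
  ultimately show ?thesis by linarith
next
  case d6: True
  define p q where "p = a 1" and "q = a 2"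
  define b where "b = a0 * (\<Prod>i\<in>{3..d}. a i)"
  have p: "p \<ge> 2" using a1 by (simp add: p_def)
  have pq: "p < q"
    using strict_mono_onD[OF mono, of 1 2] d6 by (simp add: p_def q_def)
  have q_le: "q \<le> a i" if "i \<in> {3..d}" for i
    using strict_mono_onD[OF mono, of 2 i] that by (simp add: q_def)
  have "q ^ (d - 2) = (\<Prod>i\<in>{3..d}. q)" by simp
  also have "\<dots> \<le> (\<Prod>i\<in>{3..d}. a i)"
    using q_le p pq by (intro prod_mono) auto
  finally have qP: "q ^ (d - 2) \<le> (\<Prod>i\<in>{3..d}. a i)" .
  have qpos: "q ^ (d - 2) > 0" using p pq by simp
  have "1 * (\<Prod>i\<in>{3..d}. a i) \<le> b"
    unfolding b_def using a0 qP qpos by (intro mult_right_mono) auto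
  hence qb: "q ^ (d - 2) \<le> b" using qP by simp
  hence b: "b > 0" using qpos by linarith
  obtain x1 where x1: "b + n = x1\<^sup>2"
    by (rule mult_hilbert_cube_shifted_square[OF cube, of "{3..d}"]) (auto simp: b_def)
  obtain x2 where x2: "p * b + n = x2\<^sup>2"
    by (rule mult_hilbert_cube_shifted_square[OF cube, of "insert 1 {3..d}"])
      (use d6 in \<open>auto simp: b_def p_def mult.left_commute\<close>)
  obtain x3 where x3: "q * b + n = x3\<^sup>2"
    by (rule mult_hilbert_cube_shifted_square[OF cube, of "insert 2 {3..d}"])
      (use d6 in \<open>auto simp: b_def q_def mult.left_commute\<close>)
  obtain x4 where x4: "p * q * b + n = x4\<^sup>2"
    by (rule mult_hilbert_cube_shifted_square[OF cube, of "insert 1 (insert 2 {3..d})"])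
      (use d6 in \<open>auto simp: b_def p_def q_def mult_ac\<close>)
  \<comment> \<open>The factor \<open>(p q)\<^sup>2 \<le> q ^ 4\<close> in the upper bound costs four of the \<open>d - 2\<close> factors \<open>q\<close>.\<close>
  have "q ^ 4 * q ^ (d - 6) = q ^ (d - 2)"
    using d6 by (simp flip: power_add)
  also have "\<dots> \<le> 20 * \<bar>n\<bar> ^ 3 * (p * q)\<^sup>2"
    using qb runge_bound[OF b n p pq x1 x2 x3 x4] by linarith
  also have "\<dots> \<le> 20 * \<bar>n\<bar> ^ 3 * (q * q)\<^sup>2"
    using p pq by (intro mult_left_mono power_mono mult_right_mono) auto
  also have "\<dots> = q ^ 4 * (20 * \<bar>n\<bar> ^ 3)" by (simp add: eval_nat_numeral)
  finally have "q ^ (d - 6) \<le> 20 * \<bar>n\<bar> ^ 3" using p pq by simp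
  moreover have "3 ^ (d - 6) \<le> q ^ (d - 6)" using p pq by (intro power_mono) auto
  ultimately have "(3 :: int) ^ (d - 6) \<le> 20 * \<bar>n\<bar> ^ 3" by linarith
  hence le: "(3 :: real) ^ (d - 6) \<le> 20 * real_of_int \<bar>n\<bar> ^ 3"
    by (metis (mono_tags, lifting) of_int_le_iff of_int_mult of_int_numeral of_int_power)
  have "exp (real (d - 6)) = exp 1 ^ (d - 6)" by (simp flip: exp_of_nat_mult)
  also have "\<dots> \<le> 3 ^ (d - 6)" using exp_le by (intro power_mono) auto
  also note le
  finally have "real (d - 6) \<le> ln (20 * real_of_int \<bar>n\<bar> ^ 3)"
    using n by (subst ln_ge_iff) auto
  also have "\<dots> = ln 20 + 3 * ln (real_of_int \<bar>n\<bar>)"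
    using n by (simp add: ln_mult ln_realpow)
  finally show ?thesis using d6 by (simp add: of_nat_diff)
qed

section \<open>The two estimates\<close>

text \<open>The bound \<open>1 + x \<le> exp x\<close>, at \<open>x = 1/2\<close> and \<open>x = -1/8\<close>, is sharp enough.\<close>

lemma exp_1_between_2_and_3: "2 < exp (1::real)" "exp (1::real) < 3"
proof -
  have "(3/2 :: real)\<^sup>2 \<le> exp (1/2) ^ 2"
    using exp_ge_add_one_self[of "1/2::real"] by (intro power_mono) auto
  also have "exp (1/2 :: real) ^ 2 = exp 1" by (simp flip: exp_of_nat_mult)
  finally show "2 < exp (1::real)" by (simp add: power2_eq_square)
  have "(7/8 :: real) ^ 8 \<le> exp (-1/8) ^ 8"
    using exp_ge_add_one_self[of "-1/8::real"] by (intro power_mono) auto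
  also have "exp (-1/8 :: real) ^ 8 = exp (-1)" by (simp flip: exp_of_nat_mult)
  finally have "1/3 < exp (-1 :: real)" by (simp add: power_divide)
  thus "exp (1::real) < 3" by (simp add: exp_minus field_simps)
qed

text \<open>
  Any prescribed bound can be met by tuning the exponent as long as \<open>ln N\<close> is neither \<open>0\<close> nor
  \<open>1\<close>, which holds for every integer \<open>N \<ge> 2\<close>. So finitely many \<open>N\<close> are corrected individually, and
  \<open>\<epsilon> N = 0\<close> serves from the point on where the growth comparison holds.
\<close>

lemma exists_vanishing_exponent_correction:
  fixes K :: real
  assumes K: "K > 0"
  shows "\<exists>\<epsilon>::int \<Rightarrow> real. (\<epsilon> \<longlongrightarrow> 0) at_top \<and>
    (\<forall>N\<ge>2. K * (1 + ln (real_of_int N))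
       \<le> 2 powr ((1 + \<epsilon> N) * ln (real_of_int N) / (2 * ln (ln (real_of_int N)))))"
proof -
  define D :: "int \<Rightarrow> real" where "D = (\<lambda>N. K * (1 + ln (real_of_int N)))"
  define P :: "int \<Rightarrow> bool" where
    "P = (\<lambda>N. D N \<le> 2 powr (ln (real_of_int N) / (2 * ln (ln (real_of_int N)))))"
  define \<epsilon> :: "int \<Rightarrow> real" where
    "\<epsilon> = (\<lambda>N. if P N then 0
      else log 2 (D N) * (2 * ln (ln (real_of_int N))) / ln (real_of_int N) - 1)"
  have "eventually (\<lambda>x::real. K * (1 + ln x) \<le> 2 powr (ln x / (2 * ln (ln x)))) at_top"
    using K by real_asymp
  hence "eventually P at_top"
    unfolding P_def D_def
    by (rule eventually_compose_filterlim[OF _ filterlim_real_of_int_at_top])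
  hence "eventually (\<lambda>N. \<epsilon> N = 0) at_top"
    by eventually_elim (simp add: \<epsilon>_def)
  hence "(\<epsilon> \<longlongrightarrow> 0) at_top" by (rule tendsto_eventually)
  moreover have "D N \<le> 2 powr ((1 + \<epsilon> N) * ln (real_of_int N) / (2 * ln (ln (real_of_int N))))"
    if N: "N \<ge> 2" for N
  proof (cases "P N")
    case True
    thus ?thesis by (simp add: \<epsilon>_def P_def)
  next
    case False
    have ln0: "ln (real_of_int N) > 0" using N by simp
    hence D0: "D N > 0" using K by (simp add: D_def)
    have "ln (real_of_int N) \<noteq> 1"
    proof
      assume "ln (real_of_int N) = 1"
      moreover have "exp (ln (real_of_int N)) = real_of_int N" using N by simp
      ultimately have "real_of_int N = exp 1" by simp
      hence "2 < real_of_int N" "real_of_int N < 3" using exp_1_between_2_and_3 by simp_all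
      hence "2 < N" "N < 3" by simp_all
      thus False by simp
    qed
    hence "ln (ln (real_of_int N)) \<noteq> 0" using ln0 by simp
    hence "(1 + \<epsilon> N) * ln (real_of_int N) / (2 * ln (ln (real_of_int N))) = log 2 (D N)"
      using False ln0 by (simp add: \<epsilon>_def)
    thus ?thesis using D0 by simp
  qed
  ultimately show ?thesis unfolding D_def by blast
qed

theorem theorem1p10:
  shows "(\<exists>C::real. C > 0 \<and>
      (\<forall>(d::nat) (a0::int) (a::nat \<Rightarrow> int) (n::int).
         d \<ge> 1 \<longrightarrow> a0 > 0 \<longrightarrow> a 1 \<ge> 2 \<longrightarrow> strict_mono_on {1..d} a \<longrightarrow> n \<noteq> 0 \<longrightarrow>
         mult_hilbert_cube a0 a d \<subseteq> shifted_squares n \<longrightarrow>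
         real d \<le> C * (2 powr (real (omega (n * (1 - a 1))) / 2) + ln (real_of_int \<bar>n\<bar>))))
    \<and> (\<exists>\<epsilon>::int \<Rightarrow> real. (\<epsilon> \<longlongrightarrow> 0) at_top \<and>
      (\<forall>(d::nat) (a0::int) (a::nat \<Rightarrow> int) (n::int).
         d \<ge> 1 \<longrightarrow> a0 > 0 \<longrightarrow> a 1 \<ge> 2 \<longrightarrow> strict_mono_on {1..d} a \<longrightarrow> n \<noteq> 0 \<longrightarrow>
         mult_hilbert_cube a0 a d \<subseteq> shifted_squares n \<longrightarrow>
         real d \<le> 2 powr ((1 + \<epsilon> (a 1 * \<bar>n\<bar>)) * ln (real_of_int (a 1 * \<bar>n\<bar>))
                          / (2 * ln (ln (real_of_int (a 1 * \<bar>n\<bar>)))))))"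
proof -
  define K :: real where "K = 6 + ln 20"
  have K6: "K \<ge> 6" by (simp add: K_def)
  have bound: "real d \<le> K * (1 + ln (real_of_int \<bar>n\<bar>))"
    if "a0 > 0" "a 1 \<ge> 2" "strict_mono_on {1..d} a" "n \<noteq> 0"
      "mult_hilbert_cube a0 a d \<subseteq> shifted_squares n" for d a0 n and a :: "nat \<Rightarrow> int"
  proof -
    have "ln (real_of_int \<bar>n\<bar>) \<ge> 0" using that by (intro ln_ge_zero) linarith
    hence "3 * ln (real_of_int \<bar>n\<bar>) \<le> K * ln (real_of_int \<bar>n\<bar>)"
      using K6 by (intro mult_right_mono) auto
    thus ?thesis using cube_dimension_le[OF that] by (simp add: K_def distrib_left)
  qed
  have first: "real d \<le> K * (2 powr (real (omega (n * (1 - a 1))) / 2) + ln (real_of_int \<bar>n\<bar>))"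
    if "a0 > 0" "a 1 \<ge> 2" "strict_mono_on {1..d} a" "n \<noteq> 0"
      "mult_hilbert_cube a0 a d \<subseteq> shifted_squares n" for d a0 n and a :: "nat \<Rightarrow> int"
  proof -
    have "1 \<le> 2 powr (real (omega (n * (1 - a 1))) / 2)" by (intro ge_one_powr_ge_zero) auto
    hence "K * (1 + ln (real_of_int \<bar>n\<bar>))
        \<le> K * (2 powr (real (omega (n * (1 - a 1))) / 2) + ln (real_of_int \<bar>n\<bar>))"
      using K6 by (intro mult_left_mono) auto
    thus ?thesis using bound[OF that] by linarith
  qed
  have "K > 0" using K6 by simp
  from exists_vanishing_exponent_correction[OF this]
  obtain \<epsilon> :: "int \<Rightarrow> real" where lim: "(\<epsilon> \<longlongrightarrow> 0) at_top"
    and eps: "\<And>N. N \<ge> 2 \<Longrightarrow> K * (1 + ln (real_of_int N))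
       \<le> 2 powr ((1 + \<epsilon> N) * ln (real_of_int N) / (2 * ln (ln (real_of_int N))))"
    by blast
  have second: "real d \<le> 2 powr ((1 + \<epsilon> (a 1 * \<bar>n\<bar>)) * ln (real_of_int (a 1 * \<bar>n\<bar>))
                          / (2 * ln (ln (real_of_int (a 1 * \<bar>n\<bar>)))))"
    if "a0 > 0" "a 1 \<ge> 2" "strict_mono_on {1..d} a" "n \<noteq> 0"
      "mult_hilbert_cube a0 a d \<subseteq> shifted_squares n" for d a0 n and a :: "nat \<Rightarrow> int"
  proof -
    have n1: "\<bar>n\<bar> \<ge> 1" using that by linarith
    have "2 * \<bar>n\<bar> \<le> a 1 * \<bar>n\<bar>" using that by (intro mult_right_mono) auto
    hence N2: "a 1 * \<bar>n\<bar> \<ge> 2" and nN: "\<bar>n\<bar> \<le> a 1 * \<bar>n\<bar>" using n1 by linarith+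
    have "real_of_int \<bar>n\<bar> \<le> real_of_int (a 1 * \<bar>n\<bar>)" using nN by (simp only: of_int_le_iff)
    hence "ln (real_of_int \<bar>n\<bar>) \<le> ln (real_of_int (a 1 * \<bar>n\<bar>))"
      using n1 by (intro ln_mono) linarith+
    hence "K * (1 + ln (real_of_int \<bar>n\<bar>)) \<le> K * (1 + ln (real_of_int (a 1 * \<bar>n\<bar>)))"
      using K6 by (intro mult_left_mono) auto
    also note eps[OF N2]
    finally show ?thesis using bound[OF that] by linarith
  qed
  show ?thesis
    using \<open>K > 0\<close> first lim second by blast
qed

end
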